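(* Let $\kappa\in\mathbb{Z}_p\setminus\mathbb{Z}_{\ge0}$, $\frac{1}{p-1}<b\le\frac{p}{p-1}$ and $c=b-\frac{1}{p-1}$. Then $\mathcal{S}(b,c;0)=\mathcal{R}(b,c;0)\oplus\partial^{(1)}\mathcal{S}(b,c;c)$.
   Context: Let $p$ be a prime, $q=p^a$, $\mathbb{Q}_q$ the unramified extension of $\mathbb{Q}_p$ of degree $a$, $\gamma\in\bar{\mathbb{Q}}_p$ a root of $\sum_{j\ge0}T^{p^j}/p^j$ with ${\rm ord}_p\gamma=\frac1{p-1}$, and $\Omega=\mathbb{Q}_q(\gamma^{1/q})$. Fix $n\ge1$. For $\underline i=(i_1,\dots,i_n)\in\mathbb{Z}_{\ge0}^n$ put $|\underline i|=i_1+\cdots+i_n$, $w(\underline i)=i_1+2i_2+\cdots+n\,i_n$, and $\kappa^{\underline i}=\kappa(\kappa-1)\cdots(\kappa-|\underline i|+1)$. Using formal symbols $e_1,\dots,e_n$, write $e^{\underline i}=e_1^{i_1}\cdots e_n^{i_n}$ and $e_\kappa^{\underline i}=\kappa^{\underline i}e^{\underline i}$; set $e_\kappa^{\underline i}=0$ if some entry of $\underline i$ is negative. For $\rho\in\mathbb{R}$, $\mathcal{S}(b,c;\rho)$ is the set of formal series $\sum_{r\ge0,\underline i\in\mathbb{Z}_{\ge0}^n}a(r,\underline i)t^re_\kappa^{\underline i}$ with $a(r,\underline i)\in\Omega$ and ${\rm ord}_p a(r,\underline i)\ge b(n+1)r+c\,w(\underline i)+\rho$. $\mathcal{R}(b,c;\rho)\subset\mathcal{S}(b,c;\rho)$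 is the subspace of series with $a(r,\underline i)=0$ whenever $i_1\neq0$. With $u_1,\dots,u_n$ the standard unit vectors, $\nabla_G$ is defined on monomials by $$\nabla_G(t^re_\kappa^{\underline i})=t^r\Big(e_\kappa^{\underline i+u_1}+\sum_{j=1}^{n-1}i_j\,e_\kappa^{\underline i-u_j+u_{j+1}}+(\kappa-|\underline i|+1)\,i_n\,\gamma^{n+1}t\,e_\kappa^{\underline i-u_n}\Big),$$ extended termwise, and $\partial^{(1)}=t\frac{d}{dt}+\nabla_G$. *)

theory Defs
  imports
    "HOL-Library.Extended_Real"
    "HOL-Library.Function_Algebras"
    "HOL-Computational_Algebra.Primes"
    "HOL-Algebra.Algebraic_Closure_Type"
    "HOL-Algebra.Generated_Fields"
begin

section \<open>The p-adic fields\<close>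

text \<open>The ambient field \<open>'a\<close> plays the role of the algebraic closure of the p-adic numbers, and
  \<open>v\<close> that of the normalized valuation \<open>ord_p\<close> on it, with \<open>v 0 = \<infinity>\<close>.\<close>

definition v_tendsto :: "('a::field \<Rightarrow> ereal) \<Rightarrow> (nat \<Rightarrow> 'a) \<Rightarrow> 'a \<Rightarrow> bool" where
  "v_tendsto v x y \<longleftrightarrow> (\<lambda>m. v (x m - y)) \<longlonglongrightarrow> \<infinity>"

definition v_Cauchy :: "('a::field \<Rightarrow> ereal) \<Rightarrow> (nat \<Rightarrow> 'a) \<Rightarrow> bool" where
  "v_Cauchy v x \<longleftrightarrow> (\<forall>N::real. \<exists>M. \<forall>m\<ge>M. \<forall>k\<ge>M. v (x m - x k) \<ge> ereal N)"

text \<open>The p-adic numbers: limits of sequences of rational numbers.\<close>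

definition Qp :: "('a::field_char_0 \<Rightarrow> ereal) \<Rightarrow> 'a set" where
  "Qp v = {y. \<exists>x. range x \<subseteq> \<rat> \<and> v_tendsto v x y}"

definition Zp :: "('a::field_char_0 \<Rightarrow> ereal) \<Rightarrow> 'a set" where
  "Zp v = {x \<in> Qp v. v x \<ge> 0}"

text \<open>The valuation axioms together with \<open>v p = 1\<close> force \<open>v\<close> to restrict to the usual p-adic
  valuation on the rationals; since rational Cauchy sequences converge, \<open>Qp v\<close> is then the p-adic
  completion of the rationals. So \<open>('a, v)\<close> is, up to isomorphism, the algebraic closure of the
  p-adic numbers with its normalized valuation.\<close>

locale padic_closure =
  fixes p :: nat and v :: "'a::field_char_0 \<Rightarrow> ereal"
  assumes prime_p: "prime p"
    and v_not_MInf: "v x \<noteq> -\<infinity>"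
    and v_eq_PInf_iff: "v x = \<infinity> \<longleftrightarrow> x = 0"
    and v_mult: "v (x * y) = v x + v y"
    and v_add: "v (x + y) \<ge> min (v x) (v y)"
    and v_p: "v (of_nat p) = 1"
    and rat_Cauchy_convergent:
      "range s \<subseteq> \<rat> \<Longrightarrow> v_Cauchy v s \<Longrightarrow> \<exists>y. v_tendsto v s y"
    and closure: "algebraic_closure (ring_of_type_algebra :: 'a ring) (Qp v)"

text \<open>Unramified means ramification index 1, i.e. no enlargement of the value group.\<close>

definition unramified_extension :: "('a::field_char_0 \<Rightarrow> ereal) \<Rightarrow> nat \<Rightarrow> 'a set \<Rightarrow> bool" where
  "unramified_extension v a L \<longleftrightarrow>
     subfield L (ring_of_type_algebra :: 'a ring) \<and> Qp v \<subseteq> L \<and>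
     ring.dimension (ring_of_type_algebra :: 'a ring) a (Qp v) L \<and>
     v ` (L - {0}) = v ` (Qp v - {0})"

definition adjoin :: "'a::field set \<Rightarrow> 'a \<Rightarrow> 'a set" where
  "adjoin L x = generate_field (ring_of_type_algebra :: 'a ring) (insert x L)"

text \<open>Roots of the power series \<open>\<Sum>j. T ^ (p ^ j) / p ^ j\<close>.\<close>

definition is_AH_root :: "nat \<Rightarrow> ('a::field_char_0 \<Rightarrow> ereal) \<Rightarrow> 'a \<Rightarrow> bool" where
  "is_AH_root p v g \<longleftrightarrow> v_tendsto v (\<lambda>m. \<Sum>j<m. g ^ (p ^ j) / of_nat p ^ j) 0"


section \<open>Formal series\<close>

text \<open>A multi-index \<open>(i 1, \<dots>, i n)\<close> is a function that vanishes outside \<open>{1..n}\<close>. A formal series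
  \<open>f\<close> in \<open>t, e_1, \<dots>, e_n\<close> is given by its coefficients \<open>f r i\<close> at \<open>t ^ r * e ^ i\<close>.\<close>

type_synonym 'a fseries = "nat \<Rightarrow> (nat \<Rightarrow> nat) \<Rightarrow> 'a"

definition multi_indices :: "nat \<Rightarrow> (nat \<Rightarrow> nat) set" where
  "multi_indices n = {i. \<forall>j. j \<notin> {1..n} \<longrightarrow> i j = 0}"

definition msize :: "nat \<Rightarrow> (nat \<Rightarrow> nat) \<Rightarrow> nat" where
  "msize n i = (\<Sum>j=1..n. i j)"

definition weight :: "nat \<Rightarrow> (nat \<Rightarrow> nat) \<Rightarrow> nat" where
  "weight n i = (\<Sum>j=1..n. j * i j)"

definition falling :: "'a::field_char_0 \<Rightarrow> nat \<Rightarrow> 'a" where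
  "falling \<kappa> m = (\<Prod>k<m. \<kappa> - of_nat k)"

definition scale :: "'a::field_char_0 \<Rightarrow> 'a fseries \<Rightarrow> 'a fseries" where
  "scale c f = (\<lambda>r i. c * f r i)"

text \<open>The series \<open>\<Sum> a r i * t ^ r * e_\<kappa> ^ i\<close>, where \<open>e_\<kappa> ^ i = falling \<kappa> (msize n i) * e ^ i\<close>.\<close>

definition e_series :: "nat \<Rightarrow> 'a::field_char_0 \<Rightarrow> 'a fseries \<Rightarrow> 'a fseries" where
  "e_series n \<kappa> a =
     (\<lambda>r i. if i \<in> multi_indices n then a r i * falling \<kappa> (msize n i) else 0)"

text \<open>The single term \<open>t ^ r * e_\<kappa> ^ i\<close>, for integer exponents; it is 0 if \<open>i\<close> has a negative
  entry, because then no \<open>k\<close> below equals \<open>i\<close>.\<close>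

definition e_monom :: "nat \<Rightarrow> 'a::field_char_0 \<Rightarrow> nat \<Rightarrow> (nat \<Rightarrow> int) \<Rightarrow> 'a fseries" where
  "e_monom n \<kappa> r i = e_series n \<kappa> (\<lambda>s k. if s = r \<and> (\<lambda>j. int (k j)) = i then 1 else 0)"

definition unit_vec :: "nat \<Rightarrow> nat \<Rightarrow> int" where
  "unit_vec j = (\<lambda>k. if k = j then 1 else 0)"

definition S_space ::
  "nat \<Rightarrow> ('a::field_char_0 \<Rightarrow> ereal) \<Rightarrow> 'a set \<Rightarrow> 'a \<Rightarrow> real \<Rightarrow> real \<Rightarrow> real \<Rightarrow> 'a fseries set" where
  "S_space n v \<Omega> \<kappa> b c \<rho> = {e_series n \<kappa> a |a. \<forall>r. \<forall>i\<in>multi_indices n.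
     a r i \<in> \<Omega> \<and> v (a r i) \<ge> ereal (b * (real n + 1) * real r + c * real (weight n i) + \<rho>)}"

definition R_space ::
  "nat \<Rightarrow> ('a::field_char_0 \<Rightarrow> ereal) \<Rightarrow> 'a set \<Rightarrow> 'a \<Rightarrow> real \<Rightarrow> real \<Rightarrow> real \<Rightarrow> 'a fseries set" where
  "R_space n v \<Omega> \<kappa> b c \<rho> = {e_series n \<kappa> a |a. \<forall>r. \<forall>i\<in>multi_indices n.
     a r i \<in> \<Omega> \<and> v (a r i) \<ge> ereal (b * (real n + 1) * real r + c * real (weight n i) + \<rho>) \<and>
     (i 1 \<noteq> 0 \<longrightarrow> a r i = 0)}"


section \<open>The differential operator\<close>

text \<open>The value of \<open>\<nabla>_G\<close> on \<open>t ^ r * e_\<kappa> ^ i\<close>.\<close>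

definition nabla_monom ::
  "nat \<Rightarrow> 'a::field_char_0 \<Rightarrow> 'a \<Rightarrow> nat \<Rightarrow> (nat \<Rightarrow> nat) \<Rightarrow> 'a fseries" where
  "nabla_monom n \<kappa> g r i = (let i' = (\<lambda>j. int (i j)) in
     e_monom n \<kappa> r (i' + unit_vec 1)
     + (\<Sum>j\<in>{1..<n}. scale (of_nat (i j)) (e_monom n \<kappa> r (i' - unit_vec j + unit_vec (j + 1))))
     + scale ((\<kappa> - of_nat (msize n i) + 1) * of_nat (i n) * g ^ (n + 1))
         (e_monom n \<kappa> (r + 1) (i' - unit_vec n)))"

text \<open>Termwise extension: \<open>f r i / falling \<kappa> (msize n i)\<close> is the coefficient of \<open>f\<close> at
  \<open>t ^ r * e_\<kappa> ^ i\<close> (the divisor is nonzero unless \<open>\<kappa>\<close> is a natural number). Each coefficient of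
  the result is a finite sum, by \<open>finite_nabla_support\<close>.\<close>

definition nabla :: "nat \<Rightarrow> 'a::field_char_0 \<Rightarrow> 'a \<Rightarrow> 'a fseries \<Rightarrow> 'a fseries" where
  "nabla n \<kappa> g f = (\<lambda>s k.
     \<Sum>(r, i) | i \<in> multi_indices n \<and> nabla_monom n \<kappa> g r i s k \<noteq> 0.
       f r i / falling \<kappa> (msize n i) * nabla_monom n \<kappa> g r i s k)"

definition t_deriv :: "'a::field_char_0 fseries \<Rightarrow> 'a fseries" where
  "t_deriv f = (\<lambda>r i. of_nat r * f r i)"

definition del1 :: "nat \<Rightarrow> 'a::field_char_0 \<Rightarrow> 'a \<Rightarrow> 'a fseries \<Rightarrow> 'a fseries" where
  "del1 n \<kappa> g f = t_deriv f + nabla n \<kappa> g f"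

lemma sum_fun_apply: "(\<Sum>j\<in>A. F j) s k = (\<Sum>j\<in>A. F j s k)"
  for F :: "'b \<Rightarrow> 'a::field_char_0 fseries"
  by (induction A rule: infinite_finite_induct) auto

lemma finite_nabla_support:
  "finite {(r, i). i \<in> multi_indices n \<and> nabla_monom n \<kappa> g r i s k \<noteq> 0}"
proof -
  let ?k = "\<lambda>j. int (k j)"
  define N where "N = {?k - unit_vec 1, ?k + unit_vec n}
     \<union> (\<lambda>j. ?k + unit_vec j - unit_vec (j + 1)) ` {1..<n}"
  define B where "B = {..s} \<times> (\<lambda>z j. nat (z j)) ` N"
  have "finite B" by (auto simp: B_def N_def)
  moreover have "(r, i) \<in> B" if nz: "nabla_monom n \<kappa> g r i s k \<noteq> 0" for r i
  proof -
    let ?i = "\<lambda>j. int (i j)"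
    have m0: "e_monom n \<kappa> r' z s k = 0" if "\<not> (s = r' \<and> ?k = z)" for r' z
      using that by (auto simp: e_monom_def e_series_def)
    have "(s = r \<and> ?k = ?i + unit_vec 1)
        \<or> (\<exists>j\<in>{1..<n}. s = r \<and> ?k = ?i - unit_vec j + unit_vec (j + 1))
        \<or> (s = r + 1 \<and> ?k = ?i - unit_vec n)"
    proof (rule ccontr)
      assume neg: "\<not> ?thesis"
      have "(\<Sum>j\<in>{1..<n}. scale (of_nat (i j))
               (e_monom n \<kappa> r (?i - unit_vec j + unit_vec (j + 1))) s k) = 0"
        using neg m0 by (intro sum.neutral) (auto simp: scale_def)
      moreover have "e_monom n \<kappa> r (?i + unit_vec 1) s k = 0"
        and "e_monom n \<kappa> (r + 1) (?i - unit_vec n) s k = 0"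
        using neg m0 by blast+
      ultimately show False
        using nz by (simp add: nabla_monom_def Let_def sum_fun_apply scale_def)
    qed
    then have "r \<le> s \<and> ?i \<in> N"
    proof (elim disjE bexE)
      fix j
      assume j: "j \<in> {1..<n}" and eq: "s = r \<and> ?k = ?i - unit_vec j + unit_vec (j + 1)"
      then have "?i = ?k + unit_vec j - unit_vec (j + 1)"
        by (simp add: algebra_simps)
      then show ?thesis
        using j eq unfolding N_def by blast
    qed (auto simp: N_def)
    then have "r \<le> s" and "?i \<in> N"
      by blast+
    have "i = (\<lambda>z j. nat (z j)) ?i"
      by simp
    then have "i \<in> (\<lambda>z j. nat (z j)) ` N"
      using \<open>?i \<in> N\<close> by (rule image_eqI)
    with \<open>r \<le> s\<close> show ?thesis
      unfolding B_def by simp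
  qed
  ultimately show ?thesis
    by (auto intro: finite_subset[of _ B])
qed


section \<open>Internal direct sums\<close>

text \<open>The spaces above are modules over the ring of integers of \<open>\<Omega>\<close>, and the direct sum is one of
  such modules.\<close>

definition int_submodule ::
  "('a::field_char_0 \<Rightarrow> ereal) \<Rightarrow> 'a set \<Rightarrow> 'a fseries set \<Rightarrow> bool" where
  "int_submodule v \<Omega> M \<longleftrightarrow> 0 \<in> M \<and> (\<forall>f\<in>M. \<forall>h\<in>M. f + h \<in> M) \<and>
     (\<forall>x\<in>\<Omega>. v x \<ge> 0 \<longrightarrow> (\<forall>f\<in>M. scale x f \<in> M))"

definition is_direct_sum ::
  "('a::field_char_0 \<Rightarrow> ereal) \<Rightarrow> 'a set \<Rightarrow> 'a fseries set \<Rightarrow> 'a fseries set \<Rightarrow> 'a fseries set \<Rightarrow> bool"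
where
  "is_direct_sum v \<Omega> M A B \<longleftrightarrow> int_submodule v \<Omega> M \<and> int_submodule v \<Omega> A \<and> int_submodule v \<Omega> B \<and>
     M = {f + h |f h. f \<in> A \<and> h \<in> B} \<and> A \<inter> B = {0}"

end

theory Submission
  imports Defs
begin

text \<open>On coefficients, the equation \<open>(del1 f)(r, k) = h(r, k)\<close> for all \<open>k\<close> with \<open>k 1 \<noteq> 0\<close> is a fixed-point
  equation \<open>f = h' - L f\<close>, since the summand \<open>e_1\<close> of \<open>nabla\<close> merely shifts indices. The map \<open>L\<close>
  preserves the growth condition of \<open>S_space\<close> and is topologically nilpotent for it, so a unique
  solution exists because \<open>\<Omega>\<close>, being finite-dimensional over the p-adic numbers, is complete. The
  remainder \<open>h - del1 f\<close> then lies in \<open>R_space\<close>, and uniqueness for \<open>h = 0\<close> makes the sum direct.\<close>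

section \<open>Valuations and completeness\<close>

context padic_closure
begin

abbreviation R0 :: "'a ring" where "R0 \<equiv> ring_of_type_algebra"

section \<open>Elementary inequalities for the valuation\<close>

lemma v_0 [simp]: "v 0 = \<infinity>"
  by (simp add: v_eq_PInf_iff)

lemma v_real: "x \<noteq> 0 \<Longrightarrow> \<exists>s. v x = ereal s"
  using v_not_MInf[of x] v_eq_PInf_iff[of x] by (cases "v x") auto

lemma v_1 [simp]: "v 1 = 0"
proof -
  obtain s where s: "v 1 = ereal s"
    using v_real[of 1] by auto
  have "ereal s = ereal s + ereal s"
    using v_mult[of 1 1] s by simp
  then show ?thesis
    using s by (simp add: zero_ereal_def)
qed

lemma v_minus [simp]: "v (- x) = v x"
proof -
  obtain s where s: "v (- 1) = ereal s"
    using v_real[of "- 1"] by auto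
  have "ereal s + ereal s = 0"
    using v_mult[of "- 1" "- 1"] s by simp
  then have "v (- 1) = 0"
    using s by (simp add: zero_ereal_def)
  then show ?thesis
    using v_mult[of "- 1" x] by simp
qed

lemma v_minus_commute: "v (x - y) = v (y - x)"
  using v_minus[of "x - y"] by simp

lemma v_add_ge: "N \<le> v x \<Longrightarrow> N \<le> v y \<Longrightarrow> N \<le> v (x + y)"
  using v_add[of x y] by (meson min.boundedI order_trans)

lemma v_diff_ge: "N \<le> v x \<Longrightarrow> N \<le> v y \<Longrightarrow> N \<le> v (x - y)"
  using v_add_ge[of N x "- y"] by simp

lemma v_diff_trans: "N \<le> v (x - y) \<Longrightarrow> N \<le> v (y - z) \<Longrightarrow> N \<le> v (x - z)"
  using v_add_ge[of N "x - y" "y - z"] by simp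

lemma v_sum_ge: "(\<And>i. i \<in> A \<Longrightarrow> N \<le> v (f i)) \<Longrightarrow> N \<le> v (sum f A)"
  by (induction A rule: infinite_finite_induct) (auto intro: v_add_ge)

lemma v_of_nat [simp]: "0 \<le> v (of_nat m)"
  by (induction m) (auto intro: v_add_ge)

lemma v_mult_ge: "ereal s \<le> v x \<Longrightarrow> ereal t \<le> v y \<Longrightarrow> ereal (s + t) \<le> v (x * y)"
  unfolding v_mult plus_ereal.simps(1)[symmetric] by (rule add_mono)

lemma v_mult_ge_left: "0 \<le> v x \<Longrightarrow> ereal t \<le> v y \<Longrightarrow> ereal t \<le> v (x * y)"
  using v_mult_ge[of 0 x t y] by (simp add: zero_ereal_def)

lemma v_power_ge: "ereal s \<le> v x \<Longrightarrow> ereal (real m * s) \<le> v (x ^ m)"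
proof (induction m)
  case (Suc m)
  then show ?case
    using v_mult_ge[of s x "real m * s" "x ^ m"] by (simp add: algebra_simps)
qed (simp add: zero_ereal_def)

lemma v_ge_all_imp_0:
  assumes "\<And>N::real. ereal N \<le> v x"
  shows "x = 0"
proof (rule ccontr)
  assume "x \<noteq> 0"
  then obtain s where "v x = ereal s"
    using v_real by blast
  then show False
    using assms[of "s + 1"] by simp
qed

section \<open>Limits and Cauchy sequences for the valuation\<close>

lemma v_tendsto_iff:
  "v_tendsto v x y \<longleftrightarrow> (\<forall>N::real. \<exists>M. \<forall>m\<ge>M. ereal N \<le> v (x m - y))"
proof
  assume "v_tendsto v x y"
  then show "\<forall>N::real. \<exists>M. \<forall>m\<ge>M. ereal N \<le> v (x m - y)"
    unfolding v_tendsto_def tendsto_PInfty eventually_sequentially by (meson less_imp_le)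
next
  assume *: "\<forall>N::real. \<exists>M. \<forall>m\<ge>M. ereal N \<le> v (x m - y)"
  show "v_tendsto v x y"
    unfolding v_tendsto_def tendsto_PInfty eventually_sequentially
  proof
    fix N :: real
    obtain M where "\<forall>m\<ge>M. ereal (N + 1) \<le> v (x m - y)"
      using * by blast
    then show "\<exists>M. \<forall>m\<ge>M. ereal N < v (x m - y)"
      using less_le_trans[of "ereal N" "ereal (N + 1)"] by auto
  qed
qed

lemma v_CauchyI:
  assumes "\<And>N::real. \<exists>M. \<forall>m\<ge>M. \<forall>k\<ge>m. ereal N \<le> v (x k - x m)"
  shows "v_Cauchy v x"
  unfolding v_Cauchy_def
proof
  fix N :: real
  obtain M where M: "ereal N \<le> v (x k - x m)" if "M \<le> m" "m \<le> k" for m k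
    using assms by metis
  show "\<exists>M. \<forall>m\<ge>M. \<forall>k\<ge>M. ereal N \<le> v (x m - x k)"
  proof (intro exI allI impI)
    fix m k assume "M \<le> m" "M \<le> k"
    then show "ereal N \<le> v (x m - x k)"
      using M[of m k] M[of k m] v_minus_commute[of "x m" "x k"] by (cases "m \<le> k") auto
  qed
qed

lemma v_tendsto_imp_Cauchy:
  assumes "v_tendsto v x y"
  shows "v_Cauchy v x"
proof (rule v_CauchyI)
  fix N :: real
  obtain M where M: "\<And>m. M \<le> m \<Longrightarrow> ereal N \<le> v (x m - y)"
    using assms unfolding v_tendsto_iff by meson
  have "ereal N \<le> v (x k - x m)" if "M \<le> m" "m \<le> k" for m k
    using v_diff_trans[of "ereal N" "x k" y "x m"] M[of k] M[of m] that v_minus_commute[of y "x m"]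
    by auto
  then show "\<exists>M. \<forall>m\<ge>M. \<forall>k\<ge>m. ereal N \<le> v (x k - x m)"
    by blast
qed

lemma v_Cauchy_diff:
  assumes "v_Cauchy v x" "v_Cauchy v y"
  shows "v_Cauchy v (\<lambda>m. x m - y m)"
  unfolding v_Cauchy_def
proof
  fix N :: real
  obtain M1 M2 where M: "\<forall>m\<ge>M1. \<forall>k\<ge>M1. ereal N \<le> v (x m - x k)"
    "\<forall>m\<ge>M2. \<forall>k\<ge>M2. ereal N \<le> v (y m - y k)"
    using assms unfolding v_Cauchy_def by meson
  show "\<exists>M. \<forall>m\<ge>M. \<forall>k\<ge>M. ereal N \<le> v (x m - y m - (x k - y k))"
  proof (intro exI[of _ "max M1 M2"] allI impI)
    fix m k assume "max M1 M2 \<le> m" "max M1 M2 \<le> k"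
    then have "ereal N \<le> v ((x m - x k) - (y m - y k))"
      using M v_diff_ge[of "ereal N" "x m - x k" "y m - y k"] by auto
    then show "ereal N \<le> v (x m - y m - (x k - y k))"
      by (simp add: algebra_simps)
  qed
qed

lemma v_tendsto_add:
  assumes "v_tendsto v x y" "v_tendsto v x' y'"
  shows "v_tendsto v (\<lambda>m. x m + x' m) (y + y')"
  unfolding v_tendsto_iff
proof
  fix N :: real
  obtain M1 M2 where M: "\<forall>m\<ge>M1. ereal N \<le> v (x m - y)" "\<forall>m\<ge>M2. ereal N \<le> v (x' m - y')"
    using assms unfolding v_tendsto_iff by meson
  show "\<exists>M. \<forall>m\<ge>M. ereal N \<le> v (x m + x' m - (y + y'))"
  proof (intro exI[of _ "max M1 M2"] allI impI)
    fix m assume "max M1 M2 \<le> m"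
    then have "ereal N \<le> v ((x m - y) + (x' m - y'))"
      using M v_add_ge[of "ereal N" "x m - y" "x' m - y'"] by auto
    then show "ereal N \<le> v (x m + x' m - (y + y'))"
      by (simp add: algebra_simps)
  qed
qed

lemma v_tendsto_mult_right:
  assumes "v_tendsto v x y"
  shows "v_tendsto v (\<lambda>m. x m * u) (y * u)"
proof (cases "u = 0")
  case False
  then obtain s where s: "v u = ereal s"
    using v_real by blast
  show ?thesis
    unfolding v_tendsto_iff
  proof
    fix N :: real
    obtain M where M: "\<forall>m\<ge>M. ereal (N - s) \<le> v (x m - y)"
      using assms unfolding v_tendsto_iff by meson
    have "ereal N \<le> v (x m * u - y * u)" if "M \<le> m" for m
      using v_mult_ge[of "N - s" "x m - y" s u] M that s by (simp add: algebra_simps)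
    then show "\<exists>M. \<forall>m\<ge>M. ereal N \<le> v (x m * u - y * u)"
      by blast
  qed
qed (simp add: v_tendsto_iff)

section \<open>Complete subsets\<close>

definition v_complete :: "'a set \<Rightarrow> bool" where
  "v_complete E \<longleftrightarrow> (\<forall>x. range x \<subseteq> E \<longrightarrow> v_Cauchy v x \<longrightarrow> (\<exists>y\<in>E. v_tendsto v x y))"

lemma v_completeD:
  assumes "v_complete E" "\<And>m. x m \<in> E" "v_Cauchy v x"
  obtains y where "y \<in> E" "v_tendsto v x y"
  using assms unfolding v_complete_def by (metis image_subset_iff)

text \<open>A diagonal argument: the m-th term is replaced by a rational number whose difference
  from it has valuation at least m. The rational sequence is again Cauchy, so it converges by the
  locale axiom, and its limit lies in \<open>Qp v\<close> by definition.\<close>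

lemma v_complete_Qp: "v_complete (Qp v)"
  unfolding v_complete_def
proof (intro allI impI)
  fix x assume x: "range x \<subseteq> Qp v" and cauchy: "v_Cauchy v x"
  have "\<exists>q. q \<in> \<rat> \<and> ereal (real m) \<le> v (q - x m)" for m
  proof -
    have "x m \<in> Qp v"
      using x by blast
    then obtain s where s: "range s \<subseteq> \<rat>" "v_tendsto v s (x m)"
      unfolding Qp_def by blast
    then obtain M where "\<forall>k\<ge>M. ereal (real m) \<le> v (s k - x m)"
      unfolding v_tendsto_iff by meson
    then show ?thesis
      using s(1) by blast
  qed
  then obtain q where q: "\<And>m. q m \<in> \<rat>" "\<And>m. ereal (real m) \<le> v (q m - x m)"
    by metis
  have diff: "v_tendsto v (\<lambda>m. x m - q m) 0"
    unfolding v_tendsto_iff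
  proof
    fix N :: real
    have "ereal N \<le> v (x m - q m - 0)" if "nat \<lceil>N\<rceil> \<le> m" for m
    proof -
      have "ereal N \<le> ereal (real m)"
        using that by simp
      also have "\<dots> \<le> v (x m - q m)"
        using q(2)[of m] v_minus_commute[of "x m"] by simp
      finally show ?thesis
        by simp
    qed
    then show "\<exists>M. \<forall>m\<ge>M. ereal N \<le> v (x m - q m - 0)"
      by blast
  qed
  have "v_Cauchy v (\<lambda>m. x m - (x m - q m))"
    using cauchy v_tendsto_imp_Cauchy[OF diff] by (rule v_Cauchy_diff)
  then have "v_Cauchy v q"
    by simp
  then obtain y where y: "v_tendsto v q y"
    using rat_Cauchy_convergent[of q] q(1) by blast
  moreover have "y \<in> Qp v"
    using y q(1) unfolding Qp_def by blast
  moreover have "v_tendsto v (\<lambda>m. q m + (x m - q m)) (y + 0)"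
    using y diff by (rule v_tendsto_add)
  ultimately show "\<exists>y\<in>Qp v. v_tendsto v x y"
    by auto
qed

text \<open>If elements of \<open>E\<close> came arbitrarily close to \<open>u\<close>, a sequence
  of them would converge to \<open>u\<close>, and completeness would put \<open>u\<close> into
  \<open>E\<close>. So \<open>u\<close> keeps a positive distance from \<open>E\<close>, which in
  valuations is an upper bound.\<close>

lemma v_complete_gap:
  assumes "v_complete E" "u \<notin> E"
  obtains C :: real where "\<And>y. y \<in> E \<Longrightarrow> v (u - y) < ereal C"
proof (rule ccontr)
  assume "\<not> thesis"
  then have "\<exists>y. y \<in> E \<and> ereal (real m) \<le> v (u - y)" for m :: nat
    using that[of "real m"] by (meson not_le)
  then obtain y where y: "\<And>m. y m \<in> E" "\<And>m. ereal (real m) \<le> v (u - y m)"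
    by metis
  have "v_tendsto v y u"
    unfolding v_tendsto_iff
  proof
    fix N :: real
    have "ereal N \<le> v (y m - u)" if "nat \<lceil>N\<rceil> \<le> m" for m
    proof -
      have "ereal N \<le> ereal (real m)"
        using that by simp
      also have "\<dots> \<le> v (y m - u)"
        using y(2)[of m] v_minus_commute[of u] by simp
      finally show ?thesis .
    qed
    then show "\<exists>M. \<forall>m\<ge>M. ereal N \<le> v (y m - u)"
      by blast
  qed
  moreover from this obtain z where z: "z \<in> E" "v_tendsto v y z"
    using v_completeD[OF assms(1), of y] y(1) v_tendsto_imp_Cauchy by blast
  \<comment> \<open>Uniqueness of limits: this sequence is identically 0, so \<open>u - z\<close>
    has arbitrarily large valuation.\<close>
  ultimately have "v_tendsto v (\<lambda>m. y m + y m * - 1) (u + z * - 1)"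
    by (intro v_tendsto_add v_tendsto_mult_right)
  then have "u - z = 0"
    using v_minus_commute[of u z] unfolding v_tendsto_iff
    by (intro v_ge_all_imp_0) auto
  then show False
    using z assms(2) by simp
qed

section \<open>Subfields and finite-dimensional extensions\<close>

sublocale R0: field R0
  rewrites "carrier R0 = UNIV" and "a \<oplus>\<^bsub>R0\<^esub> b = a + b" and "a \<otimes>\<^bsub>R0\<^esub> b = a * b"
    and "\<zero>\<^bsub>R0\<^esub> = 0" and "\<one>\<^bsub>R0\<^esub> = 1"
  by (rule field_from_type_algebra) (simp_all add: ring_of_type_algebra_def)


text \<open>The rewrites of the sublocale act only on facts of that locale; facts about an explicit
  ring, such as \<open>subringE\<close>, need the equations themselves.\<close>

lemma R0_simps:
  "carrier R0 = UNIV" "x \<oplus>\<^bsub>R0\<^esub> y = x + y" "x \<otimes>\<^bsub>R0\<^esub> y = x * y"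
  "\<zero>\<^bsub>R0\<^esub> = 0" "\<one>\<^bsub>R0\<^esub> = 1"
  by (simp_all add: ring_of_type_algebra_def)

lemma R0_uminus: "\<ominus>\<^bsub>R0\<^esub> x = - x"
  by (rule R0.minus_equality) auto

lemma R0_inverse: "x \<noteq> 0 \<Longrightarrow> inv\<^bsub>R0\<^esub> x = inverse x"
  by (rule R0.comm_inv_char) auto

lemma subfield_R0D:
  assumes "subfield K R0"
  shows "0 \<in> K" "1 \<in> K"
    and "x \<in> K \<Longrightarrow> y \<in> K \<Longrightarrow> x + y \<in> K" "x \<in> K \<Longrightarrow> - x \<in> K"
    and "x \<in> K \<Longrightarrow> y \<in> K \<Longrightarrow> x - y \<in> K" "x \<in> K \<Longrightarrow> y \<in> K \<Longrightarrow> x * y \<in> K"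
    and "x \<in> K \<Longrightarrow> inverse x \<in> K" "of_nat m \<in> K" "x \<in> K \<Longrightarrow> x ^ m \<in> K"
proof -
  have sr: "subring K R0"
    using assms by (rule subfieldE)
  show c: "0 \<in> K" "1 \<in> K" "x \<in> K \<Longrightarrow> y \<in> K \<Longrightarrow> x + y \<in> K" "x \<in> K \<Longrightarrow> - x \<in> K"
    "x \<in> K \<Longrightarrow> y \<in> K \<Longrightarrow> x * y \<in> K" for x y
    using subringE[OF sr] by (simp_all add: R0_simps R0_uminus)
  show "x \<in> K \<Longrightarrow> y \<in> K \<Longrightarrow> x - y \<in> K"
    using c(3)[of x "- y"] c(4) by simp
  show "inverse x \<in> K" if "x \<in> K"
    using R0.subfield_m_inv(1)[OF assms, of x] that c(1) by (cases "x = 0") (auto simp: R0_inverse)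
  show "of_nat m \<in> K"
    by (induction m) (auto intro: c)
  show "x ^ m \<in> K" if "x \<in> K"
    using that by (induction m) (auto intro: c)
qed

text \<open>The gap between \<open>u\<close> and \<open>E\<close> makes the coefficient of
  \<open>u\<close> depend continuously on the vector. Hence in a Cauchy sequence
  \<open>k m * u + y m\<close> the coefficients \<open>k m\<close> are Cauchy, then so are the
  \<open>y m\<close>, and the two limits are taken separately.\<close>

lemma v_complete_line_extension:
  assumes K: "subfield K R0" "v_complete K" and E: "v_complete E" "u \<notin> E"
    and E_diff: "\<And>x y. x \<in> E \<Longrightarrow> y \<in> E \<Longrightarrow> x - y \<in> E"
    and E_smult: "\<And>k x. k \<in> K \<Longrightarrow> x \<in> E \<Longrightarrow> k * x \<in> E"
  shows "v_complete (R0.line_extension K u E)"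
  unfolding v_complete_def
proof (intro allI impI)
  fix x assume x: "range x \<subseteq> R0.line_extension K u E" and cauchy: "v_Cauchy v x"
  have "\<exists>k y. k \<in> K \<and> y \<in> E \<and> x m = k * u + y" for m
    using x R0.line_extension_mem_iff[of "x m" K u E] by blast
  then obtain k y where k: "\<And>m. k m \<in> K" and y: "\<And>m. y m \<in> E" and xky: "\<And>m. x m = k m * u + y m"
    by metis
  obtain C where C: "\<And>z. z \<in> E \<Longrightarrow> v (u - z) < ereal C"
    using v_complete_gap[OF E] by blast
  \<comment> \<open>Dividing by \<open>l\<close> turns the vector into \<open>u - z'\<close> with
    \<open>z'\<close> in \<open>E\<close>, to which the bound \<open>C\<close> applies.\<close>
  have gap: "v (l * u + z) \<le> v l + ereal C" if "l \<in> K" "z \<in> E" for l z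
  proof (cases "l = 0")
    case False
    define z' where "z' = - inverse l * z"
    have "z' \<in> E"
      unfolding z'_def using that subfield_R0D[OF K(1)] by (intro E_smult) auto
    then have "v l + v (u - z') \<le> v l + ereal C"
      using C by (intro add_left_mono less_imp_le)
    moreover have "l * u + z = l * (u - z')"
      using False by (simp add: z'_def algebra_simps)
    ultimately show ?thesis
      by (simp add: v_mult)
  qed simp
  have "v_Cauchy v k"
    unfolding v_Cauchy_def
  proof
    fix N :: real
    obtain M where M: "\<forall>m\<ge>M. \<forall>l\<ge>M. ereal (N + C) \<le> v (x m - x l)"
      using cauchy unfolding v_Cauchy_def by meson
    have "ereal N \<le> v (k m - k l)" if "M \<le> m" "M \<le> l" for m l
    proof -
      have "x m - x l = (k m - k l) * u + (y m - y l)"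
        by (simp add: xky algebra_simps)
      then have "ereal (N + C) \<le> v (k m - k l) + ereal C"
        using M that gap[of "k m - k l" "y m - y l"] k y E_diff subfield_R0D(5)[OF K(1)]
        by (metis order_trans)
      then show ?thesis
        by (cases "v (k m - k l)") auto
    qed
    then show "\<exists>M. \<forall>m\<ge>M. \<forall>l\<ge>M. ereal N \<le> v (k m - k l)"
      by blast
  qed
  then obtain k' where k': "k' \<in> K" "v_tendsto v k k'"
    using v_completeD[OF K(2), of k] k by blast
  have ku: "v_tendsto v (\<lambda>m. k m * u) (k' * u)"
    using k'(2) by (rule v_tendsto_mult_right)
  have "v_Cauchy v (\<lambda>m. x m - k m * u)"
    using cauchy v_tendsto_imp_Cauchy[OF ku] by (rule v_Cauchy_diff)
  then have "v_Cauchy v y"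
    by (simp add: xky)
  then obtain y' where y': "y' \<in> E" "v_tendsto v y y'"
    using v_completeD[OF E(1), of y] y by blast
  have "v_tendsto v x (k' * u + y')"
    using v_tendsto_add[OF ku y'(2)] xky by presburger
  then show "\<exists>z\<in>R0.line_extension K u E. v_tendsto v x z"
    using k'(1) y'(1) R0.line_extension_mem_iff[of "k' * u + y'" K u E] by blast
qed

text \<open>The space is built up one line at a time. The intermediate spaces are only vector spaces
  over \<open>K\<close>, which is why \<open>v_complete\<close> is defined for arbitrary
  sets.\<close>

lemma v_complete_dimension:
  assumes "R0.dimension d K E" "subfield K R0" "v_complete K"
  shows "v_complete E"
  using assms
proof (induction rule: R0.dimension.induct)
  case (zero_dim K)
  have "v_tendsto v x 0" if "range x \<subseteq> {0}" for x
    using that by (auto simp: v_tendsto_iff image_subset_iff)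
  then show ?case
    unfolding v_complete_def by blast
next
  case (Suc_dim u E d K)
  note sp = R0.space_subgroup_props[OF Suc_dim.prems(1) Suc_dim.hyps(3)]
  show ?case
  proof (rule v_complete_line_extension[OF Suc_dim.prems Suc_dim.IH[OF Suc_dim.prems] Suc_dim.hyps(2)])
    fix x y assume "x \<in> E" "y \<in> E"
    then show "x - y \<in> E"
      using sp(3)[of x "- y"] sp(4)[of y] by (simp add: R0_uminus)
  qed (use sp(5) in auto)
qed

text \<open>Every \<open>x\<close> is algebraic over \<open>Qp v\<close>, so the polynomial
  expressions in \<open>x\<close> over \<open>Q\<close> already form a field and coincide with the
  generated one. This field has finite dimension over \<open>Q\<close>, hence over
  \<open>Qp v\<close> by multiplicativity of degrees, and inherits completeness.\<close>

lemma unramified_adjoin_props: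
  assumes Q: "unramified_extension v a Q"
  shows "subfield (adjoin Q x) R0" "v_complete (adjoin Q x)" "Qp v \<subseteq> adjoin Q x" "x \<in> adjoin Q x"
proof -
  interpret ac: algebraic_closure R0 "Qp v"
    by (rule closure)
  have Qp: "subfield (Qp v) R0" and alg: "(R0.algebraic over Qp v) x"
    using ac.subfield_axioms ac.algebraic_extension[of x] by (auto simp: ring_of_type_algebra_def)
  have Q: "subfield Q R0" "Qp v \<subseteq> Q" "R0.dimension a (Qp v) Q"
    using assms unfolding unramified_extension_def by auto
  have algQ: "(R0.algebraic over Q) x"
    using R0.algebraic_mono[OF Q(2) alg] .
  let ?S = "R0.simple_extension Q x"
  have S: "subfield ?S R0"
    using R0.simple_extension_is_subfield[OF Q(1)] algQ by simp
  have QS: "Q \<subseteq> ?S" "x \<in> ?S"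
    using R0.simple_extension_incl[of Q x] R0.simple_extension_mem[OF subfieldE(1)[OF Q(1)], of x] by auto
  show A: "subfield (adjoin Q x) R0"
    unfolding adjoin_def by (rule R0.generate_field_is_subfield) simp
  have QA: "insert x Q \<subseteq> adjoin Q x"
    unfolding adjoin_def by (auto intro: generate_field.incl)
  have "adjoin Q x \<subseteq> ?S"
    unfolding adjoin_def using QS S by (intro R0.generate_field_min_subfield1) auto
  moreover have "?S \<subseteq> adjoin Q x"
    using R0.simple_extension_subring_incl[OF subfieldE(1)[OF A]] QA by auto
  ultimately have eq: "adjoin Q x = ?S"
    by blast
  have "R0.finite_dimension Q ?S"
    using R0.finite_dimension_simple_extension[OF Q(1)] algQ by simp
  then obtain d where "R0.dimension d Q ?S"
    unfolding R0.finite_dimension_def by blast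
  then show "v_complete (adjoin Q x)"
    unfolding eq using R0.telescopic_base[OF Qp Q(1,3)] v_complete_dimension Qp v_complete_Qp by blast
  show "Qp v \<subseteq> adjoin Q x" "x \<in> adjoin Q x"
    using QA Q(2) by auto
qed

end

section \<open>The operator on coefficients\<close>

definition raise :: "nat \<Rightarrow> (nat \<Rightarrow> nat) \<Rightarrow> nat \<Rightarrow> nat" where
  "raise j i = i(j := Suc (i j))"

text \<open>Subtraction is truncated: if \<open>i j = 0\<close> the index is returned unchanged. The
  coefficient formulas below therefore treat a zero entry as a separate case.\<close>

definition lower :: "nat \<Rightarrow> (nat \<Rightarrow> nat) \<Rightarrow> nat \<Rightarrow> nat" where
  "lower j i = i(j := i j - 1)"

lemma raise_apply: "raise j i l = (if l = j then Suc (i j) else i l)"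
  by (simp add: raise_def)

lemma lower_apply: "lower j i l = (if l = j then i j - 1 else i l)"
  by (simp add: lower_def)

lemma raise_lower: "i j \<noteq> 0 \<Longrightarrow> raise j (lower j i) = i"
  by (auto simp: raise_def lower_def)

lemma lower_raise [simp]: "lower j (raise j i) = i"
  by (auto simp: raise_def lower_def)

lemma raise_multi_index: "j \<in> {1..n} \<Longrightarrow> i \<in> multi_indices n \<Longrightarrow> raise j i \<in> multi_indices n"
  by (auto simp: raise_def multi_indices_def)

lemma lower_multi_index: "i \<in> multi_indices n \<Longrightarrow> lower j i \<in> multi_indices n"
  by (auto simp: lower_def multi_indices_def)

lemma msize_raise: "j \<in> {1..n} \<Longrightarrow> msize n (raise j i) = msize n i + 1"
  unfolding msize_def
  by (subst (1 2) sum.remove[of _ j]) (auto simp: raise_apply intro!: sum.cong)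

lemma weight_raise: "j \<in> {1..n} \<Longrightarrow> weight n (raise j i) = weight n i + j"
  unfolding weight_def
  by (subst (1 2) sum.remove[of _ j]) (auto simp: raise_apply intro!: sum.cong)

lemma msize_le_weight: "msize n i \<le> weight n i"
  unfolding msize_def weight_def by (intro sum_mono) auto

text \<open>This lemma and the next two invert the index shifts of \<open>nabla_monom\<close>: for a
  given target \<open>k\<close> they find the only possible source \<open>i\<close> and pass from
  integer to natural exponents.\<close>

lemma int_eq_plus_unit_iff:
  "(\<lambda>l. int (k l)) = (\<lambda>l. int (i l)) + unit_vec j \<longleftrightarrow> k j \<noteq> 0 \<and> i = lower j k"
proof
  assume eq: "(\<lambda>l. int (k l)) = (\<lambda>l. int (i l)) + unit_vec j"
  have "int (k l) = int (i l) + (if l = j then 1 else 0)" for l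
    using fun_cong[OF eq, of l] by (simp add: unit_vec_def)
  then have "k l = i l + (if l = j then 1 else 0)" for l
    by (metis add.right_neutral int_ops(2) nat_int_add nat_int)
  then show "k j \<noteq> 0 \<and> i = lower j k"
    by (auto simp: lower_def fun_eq_iff)
qed (auto simp: lower_def fun_eq_iff unit_vec_def)

lemma int_eq_minus_unit_iff:
  "(\<lambda>l. int (k l)) = (\<lambda>l. int (i l)) - unit_vec j \<longleftrightarrow> i = raise j k"
proof -
  have "(\<lambda>l. int (k l)) = (\<lambda>l. int (i l)) - unit_vec j
      \<longleftrightarrow> (\<lambda>l. int (i l)) = (\<lambda>l. int (k l)) + unit_vec j"
    by (auto simp: algebra_simps)
  also have "\<dots> \<longleftrightarrow> i = raise j k"
    unfolding int_eq_plus_unit_iff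
    by (metis lower_raise raise_lower raise_apply nat.simps(3))
  finally show ?thesis .
qed

lemma int_eq_shift_iff:
  assumes "j \<noteq> l"
  shows "(\<lambda>m. int (k m)) = (\<lambda>m. int (i m)) - unit_vec j + unit_vec l
    \<longleftrightarrow> k l \<noteq> 0 \<and> i = raise j (lower l k)"
proof -
  have "(\<lambda>m. int (k m)) = (\<lambda>m. int (i m)) - unit_vec j + unit_vec l
      \<longleftrightarrow> (\<lambda>m. int (raise j k m)) = (\<lambda>m. int (i m)) + unit_vec l"
    using int_eq_minus_unit_iff[of k "raise j k" j] by (auto simp: algebra_simps)
  also have "\<dots> \<longleftrightarrow> k l \<noteq> 0 \<and> i = raise j (lower l k)"
    unfolding int_eq_plus_unit_iff using assms by (auto simp: raise_def lower_def fun_upd_twist)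
  finally show ?thesis .
qed

section \<open>The coefficients of \<open>del1\<close> with respect to
  \<open>e_\<kappa> ^ i\<close>\<close>

lemma falling_neq_0: "\<kappa> \<notin> \<nat> \<Longrightarrow> falling \<kappa> m \<noteq> 0"
  by (auto simp: falling_def)

text \<open>No falling factorial of \<kappa> vanishes, so a series determines its coefficients with
  respect to \<open>e_\<kappa> ^ i\<close> and all work can be done on coefficients.\<close>

lemma e_series_cong_iff:
  assumes "\<kappa> \<notin> \<nat>"
  shows "e_series n \<kappa> f = e_series n \<kappa> h \<longleftrightarrow> (\<forall>r. \<forall>i\<in>multi_indices n. f r i = h r i)"
  unfolding e_series_def fun_eq_iff using falling_neq_0[OF assms] by auto

text \<open>\<open>nabla\<close> without the summand \<open>e_1\<close>, plus \<open>t d/dt\<close>, on the coefficients at \<open>t ^ r * e_\<kappa> ^ k\<close>.\<close>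

definition del1_tail :: "nat \<Rightarrow> 'a::field_char_0 \<Rightarrow> 'a \<Rightarrow> 'a fseries \<Rightarrow> 'a fseries" where
  "del1_tail n \<kappa> g f r k = of_nat r * f r k
     + (\<Sum>j\<in>{1..<n}. if k (j + 1) = 0 then 0
          else of_nat (k j + 1) * f r (raise j (lower (j + 1) k)))
     + (if r = 0 then 0
        else (\<kappa> - of_nat (msize n k)) * of_nat (k n + 1) * g ^ (n + 1) * f (r - 1) (raise n k))"

text \<open>The summand \<open>e_1\<close> is kept apart from the tail: it carries the coefficient
  1, so the equation at an index with nonzero first entry can be solved for
  \<open>f r (lower 1 k)\<close>.\<close>

definition del1_coeff :: "nat \<Rightarrow> 'a::field_char_0 \<Rightarrow> 'a \<Rightarrow> 'a fseries \<Rightarrow> 'a fseries" where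
  "del1_coeff n \<kappa> g f r k = (if k 1 = 0 then 0 else f r (lower 1 k)) + del1_tail n \<kappa> g f r k"

text \<open>Each summand is put into the form of a Kronecker delta in the source
  \<open>(r, i)\<close> with a factor that depends only on the target \<open>(s, k)\<close>. At a
  source one has \<open>i j = k j + 1\<close> for the middle shifts; for the last one
  \<open>i n = k n + 1\<close> and the size of \<open>i\<close> is one more than that of
  \<open>k\<close>, so \<open>\<kappa> - of_nat (msize n i) + 1\<close> becomes
  \<open>\<kappa> - of_nat (msize n k)\<close>.\<close>

lemma nabla_monom_apply:
  assumes "n \<ge> 1"
  shows "nabla_monom n \<kappa> g r i s k = (if k \<in> multi_indices n then falling \<kappa> (msize n k) else 0) *
    ((if r = s \<and> i = lower 1 k then if k 1 = 0 then 0 else 1 else 0)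
     + (\<Sum>j\<in>{1..<n}. if r = s \<and> i = raise j (lower (j + 1) k)
          then if k (j + 1) = 0 then 0 else of_nat (k j + 1) else 0)
     + (if r = s - 1 \<and> i = raise n k
        then if s = 0 then 0 else (\<kappa> - of_nat (msize n k)) * of_nat (k n + 1) * g ^ (n + 1) else 0))"
    (is "_ = ?F * (?A + (\<Sum>j\<in>_. ?B j) + ?C)")
proof -
  let ?i = "\<lambda>j. int (i j)"
  have mono: "e_monom n \<kappa> r' z s k = (if s = r' \<and> (\<lambda>j. int (k j)) = z then ?F else 0)" for r' z
    by (simp add: e_monom_def e_series_def)
  have "e_monom n \<kappa> r (?i + unit_vec 1) s k = ?F * ?A"
    unfolding mono int_eq_plus_unit_iff by auto
  moreover have "scale (of_nat (i j)) (e_monom n \<kappa> r (?i - unit_vec j + unit_vec (j + 1))) s k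
      = ?F * ?B j" for j
    unfolding mono scale_def by (subst int_eq_shift_iff) (auto simp: raise_apply lower_apply)
  moreover have "scale ((\<kappa> - of_nat (msize n i) + 1) * of_nat (i n) * g ^ (n + 1))
      (e_monom n \<kappa> (r + 1) (?i - unit_vec n)) s k = ?F * ?C"
    unfolding mono scale_def int_eq_minus_unit_iff
    using assms by (auto simp: raise_apply msize_raise)
  ultimately show ?thesis
    by (simp add: nabla_monom_def Let_def sum_fun_apply distrib_left sum_distrib_left)
qed

text \<open>For a fixed target, the sum over sources that defines \<open>nabla\<close> is a sum of
  Kronecker deltas, and each delta picks out one coefficient of \<open>f\<close>. The common factor
  is the falling factorial of the target.\<close>

lemma del1_e_series:
  fixes \<kappa> g :: "'a::field_char_0"
  assumes "n \<ge> 1" "\<kappa> \<notin> \<nat>"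
  shows "del1 n \<kappa> g (e_series n \<kappa> f) = e_series n \<kappa> (del1_coeff n \<kappa> g f)"
  unfolding del1_def
proof (intro ext)
  fix s k
  show "(t_deriv (e_series n \<kappa> f) + nabla n \<kappa> g (e_series n \<kappa> f)) s k
      = e_series n \<kappa> (del1_coeff n \<kappa> g f) s k"
  proof (cases "k \<in> multi_indices n")
    case False
    then have "nabla_monom n \<kappa> g r i s k = 0" for r i
      using assms(1) by (simp add: nabla_monom_apply)
    then show ?thesis
      using False by (simp add: nabla_def t_deriv_def e_series_def)
  next
    case k: True
    let ?S = "{(r, i). i \<in> multi_indices n \<and> nabla_monom n \<kappa> g r i s k \<noteq> 0}"
    let ?x = "\<lambda>j. raise j (lower (j + 1) k)"
    let ?F = "falling \<kappa> (msize n k)"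
    \<comment> \<open>All candidate sources are added to the support, including those whose
      contribution is 0. The sum does not change, and every delta now has its point inside the
      finite range of summation.\<close>
    define B where "B = ?S \<union> {(s, lower 1 k), (s - 1, raise n k)} \<union> (\<lambda>j. (s, ?x j)) ` {1..<n}"
    have fin: "finite B"
      unfolding B_def using finite_nabla_support[of n \<kappa> g s k] by simp
    have BI: "snd z \<in> multi_indices n" if "z \<in> B" for z
      using that k assms(1) unfolding B_def
      by (auto intro!: lower_multi_index raise_multi_index)
    define a where "a = (\<lambda>j. if k (j + 1) = 0 then 0 else of_nat (k j + 1) :: 'a)"
    define a1 where "a1 = (if k 1 = 0 then 0 else 1 :: 'a)"
    define an where "an = (if s = 0 then 0
      else (\<kappa> - of_nat (msize n k)) * of_nat (k n + 1) * g ^ (n + 1))"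
    have monom: "nabla_monom n \<kappa> g r i s k = ?F * ((if (r, i) = (s, lower 1 k) then a1 else 0)
        + (\<Sum>j\<in>{1..<n}. if (r, i) = (s, ?x j) then a j else 0)
        + (if (r, i) = (s - 1, raise n k) then an else 0))" for r i
      using k unfolding nabla_monom_apply[OF assms(1)] a_def a1_def an_def by simp
    have delta: "(\<Sum>z\<in>B. case_prod f z * (if z = z0 then y else 0)) = case_prod f z0 * y"
      if "z0 \<in> B" for z0 and y :: 'a
      using that fin by (simp add: sum.delta if_distrib[of "\<lambda>u. _ * u"] cong: if_cong)
    have "nabla n \<kappa> g (e_series n \<kappa> f) s k
        = (\<Sum>(r, i)\<in>B. e_series n \<kappa> f r i / falling \<kappa> (msize n i) * nabla_monom n \<kappa> g r i s k)"
      unfolding nabla_def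
    proof (intro sum.mono_neutral_left fin ballI)
      show "?S \<subseteq> B"
        unfolding B_def by blast
    next
      fix z assume "z \<in> B - ?S"
      then show "(case z of (r, i) \<Rightarrow>
          e_series n \<kappa> f r i / falling \<kappa> (msize n i) * nabla_monom n \<kappa> g r i s k) = 0"
        using BI[of z] by (cases z) auto
    qed
    also have "\<dots> = (\<Sum>z\<in>B. case_prod f z * (?F * ((if z = (s, lower 1 k) then a1 else 0)
        + (\<Sum>j\<in>{1..<n}. if z = (s, ?x j) then a j else 0)
        + (if z = (s - 1, raise n k) then an else 0))))"
    proof (intro sum.cong refl)
      fix z assume "z \<in> B"
      then obtain r i where z: "z = (r, i)" "i \<in> multi_indices n"
        using BI[of z] by (cases z) auto
      then show "(case z of (r, i) \<Rightarrow>
            e_series n \<kappa> f r i / falling \<kappa> (msize n i) * nabla_monom n \<kappa> g r i s k)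
          = case_prod f z * (?F * ((if z = (s, lower 1 k) then a1 else 0)
            + (\<Sum>j\<in>{1..<n}. if z = (s, ?x j) then a j else 0)
            + (if z = (s - 1, raise n k) then an else 0)))"
        using falling_neq_0[OF assms(2), of "msize n i"] by (simp add: monom e_series_def)
    qed
    also have "\<dots> = ?F * ((\<Sum>z\<in>B. case_prod f z * (if z = (s, lower 1 k) then a1 else 0))
        + (\<Sum>j\<in>{1..<n}. \<Sum>z\<in>B. case_prod f z * (if z = (s, ?x j) then a j else 0))
        + (\<Sum>z\<in>B. case_prod f z * (if z = (s - 1, raise n k) then an else 0)))"
      unfolding sum.swap[of _ B]
      by (simp only: sum_distrib_left[symmetric] sum.distrib[symmetric] distrib_left[symmetric]
          mult.left_commute[of _ ?F])
    also have "\<dots> = ?F * (f s (lower 1 k) * a1 + (\<Sum>j\<in>{1..<n}. f s (?x j) * a j)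
        + f (s - 1) (raise n k) * an)"
    proof -
      have "(s, lower 1 k) \<in> B" "(s - 1, raise n k) \<in> B" "\<And>j. j \<in> {1..<n} \<Longrightarrow> (s, ?x j) \<in> B"
        unfolding B_def by blast+
      then show ?thesis
        by (simp add: delta)
    qed
    finally show ?thesis
      using k by (simp add: t_deriv_def e_series_def del1_coeff_def del1_tail_def a1_def a_def an_def
          algebra_simps if_distrib cong: if_cong)
  qed
qed

section \<open>The direct sum\<close>

text \<open>In the application \<open>b - c\<close> is \<open>1 / (p - 1)\<close>, the valuation of
  \<gamma>, and \<Omega> is complete because it is finite over \<open>Qp v\<close>.\<close>

locale del1_setting = padic_closure p v
  for p :: nat and v :: "'a::field_char_0 \<Rightarrow> ereal" +
  fixes n :: nat and \<Omega> :: "'a set" and \<kappa> g :: 'a and b c :: real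
  assumes n_ge_1: "n \<ge> 1"
    and Omega_subfield: "subfield \<Omega> R0" and Omega_complete: "v_complete \<Omega>"
    and kappa: "\<kappa> \<in> \<Omega>" "0 \<le> v \<kappa>" "\<kappa> \<notin> \<nat>"
    and g: "g \<in> \<Omega>" "ereal (b - c) \<le> v g"
    and c_pos: "0 < c"
begin

text \<open>Every shift in \<open>del1_tail n \<kappa> g\<close> except the one of \<open>t d/dt\<close> raises
  \<open>msize n i - weight n i - n * r\<close> by 1. Repeated application therefore either gains a factor of
  valuation \<open>c\<close> from \<open>t d/dt\<close> or increases this quantity, which is never positive.\<close>

definition bnd :: "real \<Rightarrow> real \<Rightarrow> nat \<Rightarrow> (nat \<Rightarrow> nat) \<Rightarrow> real" where
  "bnd l m r i = b * (real n + 1) * real r + c * real (weight n i)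
     + l * (real (msize n i) - real (weight n i) - real n * real r) + m"

abbreviation tail :: "'a fseries \<Rightarrow> 'a fseries" where
  "tail \<equiv> del1_tail n \<kappa> g"

section \<open>Growth estimates for \<open>tail\<close>\<close>

lemma bnd_add: "bnd l (m + x) r i = bnd l m r i + x"
  by (simp add: bnd_def)

lemma bnd_raise:
  assumes "j \<in> {1..n}"
  shows "bnd l m r (raise j i) = bnd l m r i + c * real j + l * (1 - real j)"
  using assms by (simp add: bnd_def msize_raise weight_raise algebra_simps)

text \<open>\<open>bnd 0 m\<close> is the growth condition of \<open>S_space\<close> with offset
  \<open>m\<close>. Since the quantity multiplied by \<open>l\<close> is never positive, that
  condition implies the one with \<open>l = c\<close>, under which the iteration contracts.\<close>

lemma bnd_c_le: "bnd c m r i \<le> bnd 0 m r i"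
proof -
  have "real (msize n i) \<le> real (weight n i)"
    using msize_le_weight by simp
  then have "real (msize n i) - real (weight n i) - real n * real r \<le> 0"
    using mult_nonneg_nonneg[of "real n" "real r"] by linarith
  then show ?thesis
    using c_pos by (simp add: bnd_def mult_nonneg_nonpos)
qed

text \<open>At the source of each index shift the available bound, together with the valuation of
  the factor, is exactly \<open>bnd l m r k - c + l\<close>. The term from \<open>t d/dt\<close>
  stays at the same index and satisfies \<open>bnd l m r k\<close>, which is enough since
  \<open>l \<le> c\<close>.\<close>

lemma tail_ge:
  assumes k: "k \<in> multi_indices n" and l: "l \<le> c"
    and f: "\<And>r i. i \<in> multi_indices n \<Longrightarrow> ereal (bnd l m r i) \<le> v (f r i)"
  shows "ereal (bnd l m r k - c + l) \<le> v (tail f r k)"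
  unfolding del1_tail_def
proof (intro v_add_ge v_sum_ge)
  have "ereal (bnd l m r k) \<le> v (of_nat r * f r k)"
    using f[OF k] by (intro v_mult_ge_left) auto
  then show "ereal (bnd l m r k - c + l) \<le> v (of_nat r * f r k)"
    by (rule order_trans[rotated]) (use l in simp)
next
  fix j assume j: "j \<in> {1..<n}"
  show "ereal (bnd l m r k - c + l)
    \<le> v (if k (j + 1) = 0 then 0 else of_nat (k j + 1) * f r (raise j (lower (j + 1) k)))"
  proof (cases "k (j + 1) = 0")
    case False
    \<comment> \<open>Compared with \<open>k\<close>, the source has the same size and a weight
      smaller by 1, which accounts for \<open>- c + l\<close>.\<close>
    have "bnd l m r (raise (j + 1) (lower (j + 1) k)) = bnd l m r (lower (j + 1) k) + c * (real j + 1) - l * real j"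
      using j by (subst bnd_raise) auto
    then have "bnd l m r k = bnd l m r (lower (j + 1) k) + c * (real j + 1) - l * real j"
      using raise_lower[of k "j + 1"] False by simp
    then have "bnd l m r k - c + l = bnd l m r (raise j (lower (j + 1) k))"
      using j by (subst bnd_raise) (auto simp: algebra_simps)
    then have "ereal (bnd l m r k - c + l) \<le> v (f r (raise j (lower (j + 1) k)))"
      using f[OF raise_multi_index[OF _ lower_multi_index[OF k]], of j r] j by auto
    then show ?thesis
      using False by (simp add: v_mult_ge_left del: of_nat_Suc of_nat_add)
  qed simp
next
  show "ereal (bnd l m r k - c + l) \<le> v (if r = 0 then 0
    else (\<kappa> - of_nat (msize n k)) * of_nat (k n + 1) * g ^ (n + 1) * f (r - 1) (raise n k))"
  proof (cases "r = 0")
    case False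
    have "0 \<le> v ((\<kappa> - of_nat (msize n k)) * of_nat (k n + 1))"
      unfolding zero_ereal_def using kappa(2)
      by (intro v_mult_ge_left v_diff_ge)
        (simp_all only: zero_ereal_def[symmetric] v_of_nat)
    then have "ereal (real (n + 1) * (b - c)) \<le> v ((\<kappa> - of_nat (msize n k)) * of_nat (k n + 1) * g ^ (n + 1))"
      using g(2) by (intro v_mult_ge_left v_power_ge)
    moreover have "ereal (bnd l m (r - 1) (raise n k)) \<le> v (f (r - 1) (raise n k))"
      using k n_ge_1 by (intro f raise_multi_index) auto
    ultimately have "ereal (real (n + 1) * (b - c) + bnd l m (r - 1) (raise n k))
        \<le> v ((\<kappa> - of_nat (msize n k)) * of_nat (k n + 1) * g ^ (n + 1) * f (r - 1) (raise n k))"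
      by (rule v_mult_ge)
    \<comment> \<open>Lowering \<open>r\<close> costs \<open>b * (n + 1)\<close> and raising entry
      \<open>n\<close> gains \<open>c * n\<close>; with \<open>(n + 1) * (b - c)\<close> from the
      power of \<open>g\<close> the net change is \<open>- c\<close>. The quantity multiplied by
      \<open>l\<close> changes by \<open>1 - n + n = 1\<close>.\<close>
    moreover have "real (n + 1) * (b - c) + bnd l m (r - 1) (raise n k) = bnd l m r k - c + l"
    proof -
      obtain s where "r = Suc s"
        using False by (cases r) auto
      then show ?thesis
        using n_ge_1 by (subst bnd_raise) (auto simp: bnd_def algebra_simps)
    qed
    ultimately show ?thesis
      using False by simp
  qed simp
qed

text \<open>Evaluating at \<open>raise 1 i\<close> adds \<open>c\<close> to the bound and cancels
  the loss in \<open>tail_ge\<close>. So this map preserves the growth condition for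
  \<open>l = 0\<close> and gains \<open>c\<close> at every application for
  \<open>l = c\<close>.\<close>

lemma tail_raise_1_ge:
  assumes "i \<in> multi_indices n" "l \<le> c"
    and "\<And>r i. i \<in> multi_indices n \<Longrightarrow> ereal (bnd l m r i) \<le> v (f r i)"
  shows "ereal (bnd l (m + l) r i) \<le> v (tail f r (raise 1 i))"
  using tail_ge[OF _ assms(2,3), of "raise 1 i" r] assms(1) n_ge_1 bnd_raise[of 1 l m r i]
    bnd_add[of l m l r i]
  by (simp add: raise_multi_index)

lemma tail_in_Omega:
  assumes "k \<in> multi_indices n" "\<And>r i. i \<in> multi_indices n \<Longrightarrow> f r i \<in> \<Omega>"
  shows "tail f r k \<in> \<Omega>"
proof -
  note closed = subfield_R0D[OF Omega_subfield]
  have [intro!]: "sum h A \<in> \<Omega>" if "\<And>j. j \<in> A \<Longrightarrow> h j \<in> \<Omega>" for h and A :: "nat set"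
    using that by (induction A rule: infinite_finite_induct) (auto intro: closed)
  then show ?thesis
    unfolding del1_tail_def using kappa(1) g(1) n_ge_1 assms(1)
    by (auto intro!: closed assms(2) raise_multi_index lower_multi_index
        simp del: of_nat_Suc of_nat_add power_Suc sum.atLeastLessThan_Suc)
qed

lemma tail_add: "tail (f + h) = tail f + tail h"
  by (intro ext)
    (simp add: del1_tail_def sum.distrib[symmetric] if_distrib algebra_simps cong: if_cong sum.cong)

lemma tail_scale: "tail (scale x f) = scale x (tail f)"
  by (intro ext) (simp add: del1_tail_def scale_def sum_distrib_left if_distrib algebra_simps cong: if_cong)

lemma tail_diff: "tail (\<lambda>r i. f r i - h r i) r k = tail f r k - tail h r k"
proof -
  have "(\<lambda>r i. f r i - h r i) = f + scale (- 1) h"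
    by (simp add: scale_def fun_eq_iff)
  then show ?thesis
    by (simp only: tail_add tail_scale) (simp add: scale_def)
qed

section \<open>Solving the fixed-point equation\<close>

lemma eq_0_of_bnd:
  assumes "\<And>N :: nat. ereal (bnd l (m + real N * c) r i) \<le> v x"
  shows "x = 0"
proof (rule v_ge_all_imp_0)
  fix M :: real
  obtain N :: nat where "M - bnd l m r i < real N * c"
    using reals_Archimedean3[OF c_pos] by blast
  then have "ereal M \<le> ereal (bnd l (m + real N * c) r i)"
    by (simp add: bnd_add)
  then show "ereal M \<le> v x"
    using assms order_trans by blast
qed

text \<open>The given bound implies the one with \<open>l = c\<close>; each substitution of the
  equation into itself then gains another \<open>c > 0\<close>, so every coefficient has infinite
  valuation.\<close>

lemma tail_fixed_point_unique:
  assumes fp: "\<And>r i. i \<in> multi_indices n \<Longrightarrow> f r i = - tail f r (raise 1 i)"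
    and f: "\<And>r i. i \<in> multi_indices n \<Longrightarrow> ereal (bnd 0 m r i) \<le> v (f r i)"
    and i: "i \<in> multi_indices n"
  shows "f r i = 0"
proof (rule eq_0_of_bnd)
  show "ereal (bnd c (m + real N * c) r i) \<le> v (f r i)" for N
    using i
  proof (induction N arbitrary: r i)
    case 0
    then show ?case
      using f[of i r] bnd_c_le[of m r i] by (simp add: order_trans[rotated])
  next
    case (Suc N)
    then have "ereal (bnd c (m + real N * c + c) r i) \<le> v (tail f r (raise 1 i))"
      by (intro tail_raise_1_ge) auto
    then show ?case
      using fp[OF Suc.prems, of r] by (simp add: algebra_simps)
  qed
qed

lemma v_limit_ge:
  assumes "v_tendsto v x y" "\<And>k. N \<le> k \<Longrightarrow> ereal s \<le> v (x k - z)"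
  shows "ereal s \<le> v (y - z)"
proof -
  obtain M where "\<And>k. M \<le> k \<Longrightarrow> ereal s \<le> v (x k - y)"
    using assms(1) unfolding v_tendsto_iff by meson
  then have "ereal s \<le> v (y - x (max M N))"
    using v_minus_commute[of y] by simp
  then show ?thesis
    using v_diff_trans assms(2)[of "max M N"] by auto
qed

text \<open>These are the coefficient families behind \<open>S_space\<close> with offset \<rho>.
  Values outside \<open>multi_indices n\<close> are left free because \<open>e_series\<close>
  discards them.\<close>

definition bounded_coeffs :: "real \<Rightarrow> 'a fseries set" where
  "bounded_coeffs \<rho> = {f. \<forall>r. \<forall>i\<in>multi_indices n. f r i \<in> \<Omega> \<and> ereal (bnd 0 \<rho> r i) \<le> v (f r i)}"

text \<open>Picard iteration starting from 0. The estimates with \<open>l = 0\<close> keep the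
  iterates in the required space, and those with \<open>l = c\<close> make them converge
  coefficientwise in the complete field \<Omega>.\<close>

lemma tail_fixed_point_exists:
  assumes h: "h \<in> bounded_coeffs 0"
  obtains f where "f \<in> bounded_coeffs c"
    and "\<And>r i. i \<in> multi_indices n \<Longrightarrow> f r i = h r (raise 1 i) - tail f r (raise 1 i)"
proof -
  have raise1: "raise 1 i \<in> multi_indices n" if "i \<in> multi_indices n" for i
    using that n_ge_1 by (intro raise_multi_index) auto
  \<comment> \<open>Reading \<open>h\<close> at \<open>raise 1 i\<close> increases the weight by 1;
    this is the source of the offset \<open>c\<close> for the solution.\<close>
  have h_in: "h r (raise 1 i) \<in> \<Omega>" and h_ge: "ereal (bnd 0 c r i) \<le> v (h r (raise 1 i))"
    if "i \<in> multi_indices n" for r i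
  proof -
    have "bnd 0 0 r (raise 1 i) = bnd 0 c r i"
      using n_ge_1 bnd_raise[of 1 0 0 r i] bnd_add[of 0 0 c r i] by simp
    moreover have "h r (raise 1 i) \<in> \<Omega> \<and> ereal (bnd 0 0 r (raise 1 i)) \<le> v (h r (raise 1 i))"
      using h raise1[OF that] by (simp add: bounded_coeffs_def)
    ultimately show "h r (raise 1 i) \<in> \<Omega>" "ereal (bnd 0 c r i) \<le> v (h r (raise 1 i))"
      by simp_all
  qed
  define F where "F = rec_nat (\<lambda>r i. 0) (\<lambda>_ f r i. h r (raise 1 i) - tail f r (raise 1 i))"
  have F_0: "F 0 r i = 0" and F_Suc: "F (Suc N) r i = h r (raise 1 i) - tail (F N) r (raise 1 i)" for N r i
    by (simp_all add: F_def)
  have F_in: "i \<in> multi_indices n \<Longrightarrow> F N r i \<in> \<Omega>" for N r i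
    by (induction N arbitrary: r i)
      (simp_all only: F_0 F_Suc h_in raise1 tail_in_Omega subfield_R0D[OF Omega_subfield])
  have F_ge: "i \<in> multi_indices n \<Longrightarrow> ereal (bnd 0 c r i) \<le> v (F N r i)" for N r i
  proof (induction N arbitrary: r i)
    case (Suc N)
    then have "ereal (bnd 0 (c + 0) r i) \<le> v (tail (F N) r (raise 1 i))"
      using c_pos by (intro tail_raise_1_ge) auto
    then show ?case
      unfolding F_Suc using Suc.prems by (intro v_diff_ge h_ge) auto
  qed (simp add: F_0)
  \<comment> \<open>By linearity the difference of consecutive iterates is, up to sign,
    \<open>tail\<close> of the previous difference, so each step gains \<open>c\<close>.\<close>
  have F_step: "i \<in> multi_indices n \<Longrightarrow> ereal (bnd c (c + real N * c) r i) \<le> v (F (Suc N) r i - F N r i)" for N r i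
  proof (induction N arbitrary: r i)
    case 0
    then show ?case
      using F_ge[of i r 1] bnd_c_le[of c r i] by (simp add: F_0 order_trans[rotated])
  next
    case (Suc N)
    then have "ereal (bnd c (c + real N * c + c) r i)
        \<le> v (tail (\<lambda>r i. F (Suc N) r i - F N r i) r (raise 1 i))"
      by (intro tail_raise_1_ge) auto
    moreover have F_eq: "F (Suc (Suc N)) r i - F (Suc N) r i = - tail (\<lambda>r i. F (Suc N) r i - F N r i) r (raise 1 i)"
      unfolding F_Suc[of "Suc N"] F_Suc[of N r i] tail_diff by simp
    moreover have "c + real (Suc N) * c = c + real N * c + c"
      by (simp add: algebra_simps)
    ultimately show ?case
      by (simp only: F_eq v_minus)
  qed
  have F_diff: "ereal (bnd c (c + real N * c) r i) \<le> v (F K r i - F N r i)"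
    if "i \<in> multi_indices n" "N \<le> K" for N K r i
    using that(2)
  proof (induction K rule: dec_induct)
    case (step K)
    have "bnd c (c + real N * c) r i \<le> bnd c (c + real K * c) r i"
      using step.hyps(1) c_pos by (simp add: bnd_add)
    then have "ereal (bnd c (c + real N * c) r i) \<le> v (F (Suc K) r i - F K r i)"
      using F_step[OF that(1), of K r] by (simp add: order_trans[rotated])
    then show ?case
      using step.IH by (rule v_diff_trans)
  qed simp
  have lim: "\<exists>y. y \<in> \<Omega> \<and> v_tendsto v (\<lambda>N. F N r i) y" if i: "i \<in> multi_indices n" for r i
  proof -
    have cauchy: "v_Cauchy v (\<lambda>N. F N r i)"
    proof (rule v_CauchyI)
      fix M :: real
      obtain N0 :: nat where N0: "M - bnd c c r i < real N0 * c"
        using reals_Archimedean3[OF c_pos] by blast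
      have "ereal M \<le> v (F K r i - F N r i)" if "N0 \<le> N" "N \<le> K" for N K
      proof -
        have "real N0 * c \<le> real N * c"
          using that c_pos by simp
        then have "ereal M \<le> ereal (bnd c (c + real N * c) r i)"
          using N0 by (simp add: bnd_add)
        then show ?thesis
          using F_diff[OF i that(2), of r] by (rule order_trans)
      qed
      then show "\<exists>M'. \<forall>N\<ge>M'. \<forall>K\<ge>N. ereal M \<le> v (F K r i - F N r i)"
        by blast
    qed
    obtain y where "y \<in> \<Omega>" "v_tendsto v (\<lambda>N. F N r i) y"
      by (rule v_completeD[OF Omega_complete F_in[OF i] cauchy])
    then show ?thesis
      by blast
  qed
  define f where "f = (\<lambda>r i. SOME y. y \<in> \<Omega> \<and> v_tendsto v (\<lambda>N. F N r i) y)"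
  have f_in: "f r i \<in> \<Omega>" and f_lim: "v_tendsto v (\<lambda>N. F N r i) (f r i)"
    if "i \<in> multi_indices n" for r i
    using someI_ex[OF lim[OF that, of r]] unfolding f_def by simp_all
  have f_ge: "ereal (bnd 0 c r i) \<le> v (f r i)" if "i \<in> multi_indices n" for r i
    using v_limit_ge[OF f_lim[OF that], where z = 0 and N = 0] F_ge[OF that] by simp
  have f_diff: "ereal (bnd c (c + real N * c) r i) \<le> v (f r i - F N r i)" if "i \<in> multi_indices n" for N r i
    using v_limit_ge[OF f_lim[OF that]] F_diff[OF that] by blast
  have f_eq: "f r i = h r (raise 1 i) - tail f r (raise 1 i)" if i: "i \<in> multi_indices n" for r i
  proof -
    \<comment> \<open>For every \<open>N\<close> the defect equals \<open>f - F (Suc N)\<close> at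
      \<open>i\<close> plus \<open>tail (f - F N)\<close> at \<open>raise 1 i\<close>. Both summands
      satisfy a bound that grows with \<open>N\<close>, so the defect vanishes.\<close>
    have "f r i - (h r (raise 1 i) - tail f r (raise 1 i)) = 0"
    proof (rule eq_0_of_bnd)
      fix N :: nat
      have "ereal (bnd c (c + real N * c + c) r i) \<le> v (tail (\<lambda>r i. f r i - F N r i) r (raise 1 i))"
        using i f_diff by (intro tail_raise_1_ge) auto
      moreover have "ereal (bnd c (c + real N * c + c) r i) \<le> v (f r i - F (Suc N) r i)"
        using f_diff[OF i, of "Suc N" r] by (simp add: algebra_simps)
      ultimately have "ereal (bnd c (c + real N * c + c) r i)
          \<le> v (f r i - F (Suc N) r i + tail (\<lambda>r i. f r i - F N r i) r (raise 1 i))"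
        by (intro v_add_ge)
      then show "ereal (bnd c (c + c + real N * c) r i) \<le> v (f r i - (h r (raise 1 i) - tail f r (raise 1 i)))"
        by (simp add: F_Suc tail_diff algebra_simps)
    qed
    then show ?thesis
      by simp
  qed
  show thesis
  proof (rule that)
    show "f \<in> bounded_coeffs c"
      using f_in f_ge by (simp add: bounded_coeffs_def)
  qed (rule f_eq)
qed

section \<open>The direct sum, transported from coefficients to series\<close>

lemma S_space_eq: "S_space n v \<Omega> \<kappa> b c \<rho> = e_series n \<kappa> ` bounded_coeffs \<rho>"
  by (auto simp: S_space_def bounded_coeffs_def bnd_def)

lemma R_space_eq:
  "R_space n v \<Omega> \<kappa> b c \<rho>
    = e_series n \<kappa> ` {f \<in> bounded_coeffs \<rho>. \<forall>r. \<forall>i\<in>multi_indices n. i 1 \<noteq> 0 \<longrightarrow> f r i = 0}"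
  by (auto simp: R_space_def bounded_coeffs_def bnd_def)

lemma del1_coeff_add: "del1_coeff n \<kappa> g (f + h) = del1_coeff n \<kappa> g f + del1_coeff n \<kappa> g h"
  unfolding del1_coeff_def tail_add by (simp add: fun_eq_iff)

lemma del1_coeff_scale: "del1_coeff n \<kappa> g (scale x f) = scale x (del1_coeff n \<kappa> g f)"
  unfolding del1_coeff_def tail_scale by (simp add: fun_eq_iff scale_def algebra_simps)

text \<open>The indices with nonzero first entry are exactly the raised ones, so prescribing the
  values here amounts to a fixed-point equation for \<open>f\<close>.\<close>

lemma del1_coeff_raise_1: "del1_coeff n \<kappa> g f r (raise 1 i) = f r i + tail f r (raise 1 i)"
  by (simp add: del1_coeff_def raise_apply)

text \<open>The operator loses exactly the offset \<open>c\<close>: the summand \<open>e_1\<close>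
  increases the weight by 1, and \<open>tail_ge\<close> with \<open>l = 0\<close> loses
  \<open>c\<close> on the rest.\<close>

lemma del1_coeff_in_bounded_coeffs:
  assumes f: "f \<in> bounded_coeffs c"
  shows "del1_coeff n \<kappa> g f \<in> bounded_coeffs 0"
proof -
  have f': "f r i \<in> \<Omega>" "ereal (bnd 0 c r i) \<le> v (f r i)" if "i \<in> multi_indices n" for r i
    using f that by (auto simp: bounded_coeffs_def)
  have "del1_coeff n \<kappa> g f r k \<in> \<Omega> \<and> ereal (bnd 0 0 r k) \<le> v (del1_coeff n \<kappa> g f r k)"
    if k: "k \<in> multi_indices n" for r k
  proof -
    have "bnd 0 c r (lower 1 k) = bnd 0 0 r k" if "k 1 \<noteq> 0"
      using raise_lower[of k 1, OF that] n_ge_1 bnd_raise[of 1 0 0 r "lower 1 k"]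
        bnd_add[of 0 0 c r "lower 1 k"] by simp
    then have "ereal (bnd 0 0 r k) \<le> v (if k 1 = 0 then 0 else f r (lower 1 k))"
      using f'(2)[OF lower_multi_index[OF k], of r 1] by (cases "k 1 = 0") simp_all
    moreover have "ereal (bnd 0 0 r k) \<le> v (tail f r k)"
      using tail_ge[OF k _ f'(2), of r] c_pos bnd_add[of 0 0 c r k] by simp
    moreover have "tail f r k \<in> \<Omega>"
      using tail_in_Omega[OF k f'(1)] .
    moreover have "(if k 1 = 0 then 0 else f r (lower 1 k)) \<in> \<Omega>"
      using f'(1)[OF lower_multi_index[OF k]] subfield_R0D(1)[OF Omega_subfield] by simp
    ultimately show ?thesis
      unfolding del1_coeff_def by (intro conjI subfield_R0D(3)[OF Omega_subfield] v_add_ge)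
  qed
  then show ?thesis
    by (simp add: bounded_coeffs_def)
qed

lemma int_submodule_bounded_coeffs: "int_submodule v \<Omega> (bounded_coeffs \<rho>)"
  unfolding int_submodule_def bounded_coeffs_def
  using subfield_R0D(1,3,6)[OF Omega_subfield] by (simp add: scale_def v_add_ge v_mult_ge_left)

lemma int_submodule_image:
  assumes "int_submodule v \<Omega> M"
    and add: "\<And>f h. L (f + h) = L f + L h" and scale: "\<And>x f. L (scale x f) = scale x (L f)"
  shows "int_submodule v \<Omega> (L ` M)"
proof -
  have "scale 0 f = 0" for f :: "'a fseries"
    by (simp add: scale_def fun_eq_iff)
  then have "L 0 = 0"
    using scale[of 0 0] by simp
  moreover have "0 \<in> M"
    using assms(1) by (simp add: int_submodule_def)
  ultimately have "0 \<in> L ` M"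
    by force
  then show ?thesis
    using assms(1) unfolding int_submodule_def by (auto simp: add[symmetric] scale[symmetric])
qed

lemma e_series_add: "e_series n \<kappa> (f + h) = e_series n \<kappa> f + e_series n \<kappa> h"
  by (simp add: e_series_def fun_eq_iff algebra_simps)

lemma e_series_scale: "e_series n \<kappa> (scale x f) = scale x (e_series n \<kappa> f)"
  by (simp add: e_series_def scale_def fun_eq_iff)

theorem S_space_direct_sum:
  "is_direct_sum v \<Omega> (S_space n v \<Omega> \<kappa> b c 0)
     (R_space n v \<Omega> \<kappa> b c 0) (del1 n \<kappa> g ` S_space n v \<Omega> \<kappa> b c c)"
proof -
  let ?e = "e_series n \<kappa>" and ?D = "del1_coeff n \<kappa> g"
  let ?R = "{f \<in> bounded_coeffs 0. \<forall>r. \<forall>i\<in>multi_indices n. i 1 \<noteq> 0 \<longrightarrow> f r i = 0}"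
  have del: "del1 n \<kappa> g ` S_space n v \<Omega> \<kappa> b c c = ?e ` ?D ` bounded_coeffs c"
    by (simp add: S_space_eq image_image del1_e_series[OF n_ge_1 kappa(3)])
  note image = int_submodule_image[OF _ e_series_add e_series_scale]
  have R: "int_submodule v \<Omega> ?R"
    using int_submodule_bounded_coeffs[of 0] unfolding int_submodule_def by (auto simp: scale_def)
  have D: "int_submodule v \<Omega> (?D ` bounded_coeffs c)"
    using int_submodule_bounded_coeffs by (rule int_submodule_image[OF _ del1_coeff_add del1_coeff_scale])
  have diff: "f - h \<in> bounded_coeffs 0" if "f \<in> bounded_coeffs 0" "h \<in> bounded_coeffs 0" for f h
    using that by (auto simp: bounded_coeffs_def intro: v_diff_ge subfield_R0D(5)[OF Omega_subfield])
  have sum: "?e ` bounded_coeffs 0 = {f + h |f h. f \<in> ?e ` ?R \<and> h \<in> ?e ` ?D ` bounded_coeffs c}"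
  proof (intro equalityI subsetI)
    fix x assume "x \<in> ?e ` bounded_coeffs 0"
    then obtain h where h: "h \<in> bounded_coeffs 0" "x = ?e h"
      by blast
    obtain f where f: "f \<in> bounded_coeffs c"
      and f_eq: "\<And>r i. i \<in> multi_indices n \<Longrightarrow> f r i = h r (raise 1 i) - tail f r (raise 1 i)"
      using tail_fixed_point_exists[OF h(1)] by blast
    \<comment> \<open>Such a \<open>k\<close> is \<open>raise 1 (lower 1 k)\<close>, and
      \<open>f\<close> was chosen so that \<open>?D f\<close> agrees with \<open>h\<close>
      there.\<close>
    have "(h - ?D f) r k = 0" if "k \<in> multi_indices n" "k 1 \<noteq> 0" for r k
      using del1_coeff_raise_1[of f r "lower 1 k"] f_eq[OF lower_multi_index[OF that(1)], of r 1]
        raise_lower[of k 1] that(2) by simp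
    then have "h - ?D f \<in> ?R"
      using diff[OF h(1) del1_coeff_in_bounded_coeffs[OF f]] by blast
    moreover have "x = ?e (h - ?D f) + ?e (?D f)"
      unfolding h(2) e_series_add[symmetric] by simp
    ultimately show "x \<in> {f + h |f h. f \<in> ?e ` ?R \<and> h \<in> ?e ` ?D ` bounded_coeffs c}"
      using f by blast
  next
    fix x assume "x \<in> {f + h |f h. f \<in> ?e ` ?R \<and> h \<in> ?e ` ?D ` bounded_coeffs c}"
    then obtain f h where "x = ?e (f + ?D h)" "f \<in> bounded_coeffs 0" "h \<in> bounded_coeffs c"
      by (auto simp: e_series_add)
    moreover have "f + ?D h \<in> bounded_coeffs 0"
      using calculation(2) del1_coeff_in_bounded_coeffs[OF calculation(3)] int_submodule_bounded_coeffs[of 0]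
      by (simp add: int_submodule_def)
    ultimately show "x \<in> ?e ` bounded_coeffs 0"
      by blast
  qed
  have eq_0: "x = 0" if x: "x \<in> ?e ` ?R" "x \<in> ?e ` ?D ` bounded_coeffs c" for x
  proof -
    obtain h f where h: "h \<in> ?R" "x = ?e h" and f: "f \<in> bounded_coeffs c" "x = ?e (?D f)"
      using x by blast
    have eq: "?D f r k = h r k" if "k \<in> multi_indices n" for r k
      using h(2) f(2) that e_series_cong_iff[OF kappa(3), of n "?D f" h] by simp
    \<comment> \<open>A common element has vanishing coefficients wherever the first entry is
      nonzero, so \<open>f\<close> solves the homogeneous fixed-point equation.\<close>
    have "f r i = 0" if "i \<in> multi_indices n" for r i
    proof (rule tail_fixed_point_unique[OF _ _ that])
      fix r i assume i: "i \<in> multi_indices n"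
      then have "raise 1 i \<in> multi_indices n"
        using n_ge_1 by (intro raise_multi_index) auto
      then have "?D f r (raise 1 i) = 0"
        using eq[of "raise 1 i" r] h(1) by (simp add: raise_apply)
      then show "f r i = - tail f r (raise 1 i)"
        unfolding del1_coeff_raise_1 by (simp add: eq_neg_iff_add_eq_0)
      show "ereal (bnd 0 c r i) \<le> v (f r i)"
        using f(1) i by (simp add: bounded_coeffs_def)
    qed
    \<comment> \<open>Outside the multi-indices \<open>f\<close> may be nonzero, so
      \<open>f = 0\<close> cannot be concluded; but at a multi-index \<open>?D f\<close> reads
      \<open>f\<close> only at multi-indices.\<close>
    then have "?D f r k = 0" if "k \<in> multi_indices n" for r k
      using that n_ge_1 unfolding del1_coeff_def del1_tail_def
      by (auto intro!: sum.neutral simp: lower_multi_index raise_multi_index)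
    then show "x = 0"
      unfolding f(2) by (simp add: e_series_def fun_eq_iff)
  qed
  have zero: "0 \<in> M" if "int_submodule v \<Omega> M" for M
    using that by (simp add: int_submodule_def)
  have inter: "?e ` ?R \<inter> ?e ` ?D ` bounded_coeffs c = {0}"
  proof (intro equalityI subsetI)
    fix x assume "x \<in> ?e ` ?R \<inter> ?e ` ?D ` bounded_coeffs c"
    then show "x \<in> {0}"
      using eq_0[of x] by (simp only: Int_iff singleton_iff)
  next
    fix x :: "'a fseries" assume "x \<in> {0}"
    then show "x \<in> ?e ` ?R \<inter> ?e ` ?D ` bounded_coeffs c"
      using zero[OF image[OF R]] zero[OF image[OF D]] by (simp only: Int_iff singleton_iff)
  qed
  show ?thesis
    unfolding is_direct_sum_def del unfolding S_space_eq R_space_eq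
    by (intro conjI image int_submodule_bounded_coeffs R D sum inter)
qed

end

section \<open>Specialisation to \<open>\<Omega> = adjoin Qq \<delta>\<close>\<close>

theorem theorem3p4:
  fixes v :: "'a::field_char_0 \<Rightarrow> ereal" and p a n :: nat
    and Qq \<Omega> :: "'a set" and \<gamma> \<delta> \<kappa> :: 'a and b c :: real
  assumes closure: "padic_closure p v"
    and a: "a \<ge> 1"
    and Qq: "unramified_extension v a Qq"
    and gamma_root: "is_AH_root p v \<gamma>"
    and gamma_ord: "v \<gamma> = ereal (1 / (real p - 1))"
    and delta: "\<delta> ^ (p ^ a) = \<gamma>"
    and Omega: "\<Omega> = adjoin Qq \<delta>"
    and n: "n \<ge> 1"
    and kappa: "\<kappa> \<in> Zp v - \<nat>"
    and b: "1 / (real p - 1) < b" "b \<le> real p / (real p - 1)"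
    and c: "c = b - 1 / (real p - 1)"
  shows "is_direct_sum v \<Omega> (S_space n v \<Omega> \<kappa> b c 0)
           (R_space n v \<Omega> \<kappa> b c 0) (del1 n \<kappa> \<gamma> ` S_space n v \<Omega> \<kappa> b c c)"
proof -
  interpret padic_closure p v
    by (rule closure)
  note \<Omega> = unramified_adjoin_props[OF Qq, of \<delta>, folded Omega]
  have "\<gamma> \<in> \<Omega>"
    using subfield_R0D(9)[OF \<Omega>(1,4)] delta by blast
  moreover have "\<kappa> \<in> \<Omega>" "0 \<le> v \<kappa>" "\<kappa> \<notin> \<nat>"
    using kappa \<Omega>(3) by (auto simp: Zp_def)
  \<comment> \<open>Here \<open>b - c\<close> equals the valuation of \<gamma>, and the lower bound
    on \<open>b\<close> says that \<open>c\<close> is positive.\<close>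
  moreover have "ereal (b - c) \<le> v \<gamma>" "0 < c"
    using c b(1) by (simp_all add: gamma_ord)
  ultimately have "del1_setting p v n \<Omega> \<kappa> \<gamma> b c"
    using n \<Omega>(1,2) by (intro del1_setting.intro del1_setting_axioms.intro padic_closure_axioms)
  then show ?thesis
    by (rule del1_setting.S_space_direct_sum)
qed

end
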